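(* Let $n\ge1$ and let $W$ be a nonnegative random variable. When $P(W=0)=1$, $\sigma_n(W)=0$. Otherwise (i.e. when $P(W=0)<1$), for any $W$ with $\mathbb{E}W^n<\infty$, for each $k\in K_n$ there is a unique positive root $\alpha_k$ of the polynomial $g_k(\alpha)=\mathbb{E}\left[W^k(\alpha-W)^{n-k}\right]$, $$\sigma_n(W)=\max\{\alpha_k:\ k\in K_n\},$$ and $\rho\big((W/\sigma_n(W))\circ n\big)=1$. Consequently, for any $W\in\mathbb{B}(n)$ we have $\rho(W\circ n)=\sigma_n(W)$.
   Context: Notation. $K_n=\{k\in\{0,1,\ldots,n\}: n-k\text{ is odd}\}$. $\mathbb{B}(n)$ is the set of (distributions of) nonnegative random variables $W$ with $\mathbb{E}W^n<\infty$ and $\mathbb{E}[W^k(1-W)^{n-k}]\ge0$ for every $k\in K_n$ (with $x^0=1$ for all $x$). For $W\in\mathbb{B}(n)$, $W\circ n$ denotes a random variable with distribution $P(W\circ n=k)=\binom nk\mathbb{E}[W^k(1-W)^{n-k}]$, $k=0,1,\ldots,n$ (equivalently, with $\mathbb{E}(1-s)^{W\circ n}=\mathbb{E}(1-sW)^n$). For a nonnegative random variable $W$ with $\mathbb{E}W^n<\infty$, $\sigma_n(W)=\inf\{\alpha\in(0,\infty): W/\alpha\in\mathbb{B}(n)\}$. $\mathbb{M}_1$ is the family of all probability distributions supported in $\mathbb{Z}_+=\{0,1,2,\ldots\}$; $X\in\mathbb{M}_1$ means that the distribution of $X$ is in $\mathbb{M}_1$. $\sim$ means equality in distribution. For $X\in\mathbb{M}_1$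 and $\alpha\in[0,1]$, $\alpha\circ X$ denotes a random variable distributed as $\sum_{i=1}^X B_i$ (empty sum $=0$), where $B_1,B_2,\ldots$ are i.i.d. with $P(B_i=1)=\alpha=1-P(B_i=0)$, independent of $X$. $X\in\mathbb{M}_\alpha$ means $X\sim\alpha\circ Z$ for some $Z\in\mathbb{M}_1$. For $X\in\mathbb{M}_1$, $\rho(X)=\inf\{\alpha\in[0,1]: X\in\mathbb{M}_\alpha\}$. *)

theory Defs
  imports "HOL-Probability.Probability"
begin

text \<open>
  A random variable \<open>W\<close> lives on an arbitrary probability space \<open>M\<close>; it enters only through its
  distribution. In particular ``nonnegative'' means nonnegative almost surely.
  Distributions on the nonnegative integers are represented by \<^typ>\<open>nat pmf\<close>.
\<close>

definition K :: "nat \<Rightarrow> nat set" where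
  "K n = {k. k \<le> n \<and> odd (n - k)}"

definition g :: "'a measure \<Rightarrow> ('a \<Rightarrow> real) \<Rightarrow> nat \<Rightarrow> nat \<Rightarrow> real \<Rightarrow> real" where
  "g M W n k \<alpha> = (\<integral>\<omega>. W \<omega> ^ k * (\<alpha> - W \<omega>) ^ (n - k) \<partial>M)"

definition BB :: "'a measure \<Rightarrow> nat \<Rightarrow> ('a \<Rightarrow> real) set" where
  "BB M n = {W \<in> borel_measurable M. (AE \<omega> in M. 0 \<le> W \<omega>) \<and> integrable M (\<lambda>\<omega>. W \<omega> ^ n) \<and>
     (\<forall>k\<in>K n. 0 \<le> (\<integral>\<omega>. W \<omega> ^ k * (1 - W \<omega>) ^ (n - k) \<partial>M))}"

definition sigma_n :: "'a measure \<Rightarrow> nat \<Rightarrow> ('a \<Rightarrow> real) \<Rightarrow> real" where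
  "sigma_n M n W = Inf {\<alpha>. 0 < \<alpha> \<and> (\<lambda>\<omega>. W \<omega> / \<alpha>) \<in> BB M n}"

text \<open>
  The distribution of \<open>W \<circ> n\<close>. It is meaningful for \<open>W \<in> BB M n\<close> only; that the weights then
  form a probability mass function is shown in \<open>pmf_circ\<close> below. For \<open>k > n\<close> the binomial
  coefficient makes the weight vanish.
\<close>

definition circ :: "'a measure \<Rightarrow> ('a \<Rightarrow> real) \<Rightarrow> nat \<Rightarrow> nat pmf" where
  "circ M W n =
     embed_pmf (\<lambda>k. real (n choose k) * (\<integral>\<omega>. W \<omega> ^ k * (1 - W \<omega>) ^ (n - k) \<partial>M))"

definition thin :: "real \<Rightarrow> nat pmf \<Rightarrow> nat pmf" where
  "thin \<alpha> X = bind_pmf X (\<lambda>x.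
     map_pmf (\<lambda>B. \<Sum>i<x. of_bool (B i)) (Pi_pmf {..<x} False (\<lambda>_. bernoulli_pmf \<alpha>)))"

definition MM :: "real \<Rightarrow> nat pmf set" where
  "MM \<alpha> = {X. \<exists>Z. X = thin \<alpha> Z}"

definition rho :: "nat pmf \<Rightarrow> real" where
  "rho X = Inf {\<alpha> \<in> {0..1}. X \<in> MM \<alpha>}"

lemma thin_eq_binomial:
  assumes "\<alpha> \<in> {0..1}"
  shows "thin \<alpha> X = bind_pmf X (\<lambda>x. binomial_pmf x \<alpha>)"
proof -
  have "map_pmf (\<lambda>B. \<Sum>i<x. of_bool (B i)) (Pi_pmf {..<x} False (\<lambda>_. bernoulli_pmf \<alpha>))
      = binomial_pmf x \<alpha>" for x
  proof -
    have "(\<Sum>i<x. of_bool (B i)) = card {i\<in>{..<x}. B i}" for B :: "nat \<Rightarrow> bool"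
      by (simp add: of_bool_def sum.If_cases Int_def)
    thus ?thesis
      using assms by (subst binomial_pmf_altdef'[of "{..<x}" x]) auto
  qed
  thus ?thesis by (simp add: thin_def)
qed

lemma integrable_bernstein:
  fixes W :: "'a \<Rightarrow> real"
  assumes "prob_space M" "W \<in> borel_measurable M" "AE \<omega> in M. 0 \<le> W \<omega>"
    and "integrable M (\<lambda>\<omega>. W \<omega> ^ n)" "k \<le> n"
  shows "integrable M (\<lambda>\<omega>. W \<omega> ^ k * (\<alpha> - W \<omega>) ^ (n - k))"
proof -
  interpret prob_space M by fact
  define c where "c = 1 + \<bar>\<alpha>\<bar>"
  have c: "c \<ge> 1" by (simp add: c_def)
  have bound: "\<bar>x ^ k * (\<alpha> - x) ^ (n - k)\<bar> \<le> c ^ n * (1 + x ^ n)" if x: "0 \<le> x" for x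
  proof -
    define m where "m = max 1 x"
    have m: "m \<ge> 1" "x \<le> m" by (auto simp: m_def)
    have "c * m = m + \<bar>\<alpha>\<bar> * m" by (simp add: c_def algebra_simps)
    moreover have "\<bar>\<alpha>\<bar> \<le> \<bar>\<alpha>\<bar> * m"
      using m by (simp add: mult_le_cancel_left1)
    ultimately have "\<bar>\<alpha>\<bar> + m \<le> c * m" by simp
    hence le: "\<bar>\<alpha> - x\<bar> \<le> c * m" "\<bar>x\<bar> \<le> c * m" using m x by auto
    have "\<bar>x ^ k * (\<alpha> - x) ^ (n - k)\<bar> = \<bar>x\<bar> ^ k * \<bar>\<alpha> - x\<bar> ^ (n - k)"
      by (simp add: abs_mult power_abs)
    also have "\<dots> \<le> (c * m) ^ k * (c * m) ^ (n - k)"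
      using le c m by (intro mult_mono power_mono) auto
    also have "\<dots> = c ^ n * m ^ n"
      using \<open>k \<le> n\<close> by (simp flip: power_add power_mult_distrib)
    also have "\<dots> \<le> c ^ n * (1 + x ^ n)"
      using x c by (intro mult_left_mono) (auto simp: m_def max_def)
    finally show ?thesis .
  qed
  show ?thesis
  proof (rule Bochner_Integration.integrable_bound)
    show "integrable M (\<lambda>\<omega>. c ^ n * (1 + W \<omega> ^ n))" using assms(4) by auto
    show "(\<lambda>\<omega>. W \<omega> ^ k * (\<alpha> - W \<omega>) ^ (n - k)) \<in> borel_measurable M" using assms(2) by simp
    show "AE \<omega> in M. norm (W \<omega> ^ k * (\<alpha> - W \<omega>) ^ (n - k)) \<le> norm (c ^ n * (1 + W \<omega> ^ n))"
      using assms(3)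
    proof eventually_elim
      case (elim \<omega>)
      show ?case using bound[OF elim] unfolding real_norm_def by linarith
    qed
  qed
qed

lemma pmf_circ:
  assumes "prob_space M" "W \<in> BB M n"
  shows "pmf (circ M W n) k =
    real (n choose k) * (\<integral>\<omega>. W \<omega> ^ k * (1 - W \<omega>) ^ (n - k) \<partial>M)"
proof -
  interpret prob_space M by fact
  define p where
    "p k = real (n choose k) * (\<integral>\<omega>. W \<omega> ^ k * (1 - W \<omega>) ^ (n - k) \<partial>M)" for k
  have W: "W \<in> borel_measurable M" "AE \<omega> in M. 0 \<le> W \<omega>" "integrable M (\<lambda>\<omega>. W \<omega> ^ n)"
    using assms(2) by (auto simp: BB_def)
  have nonneg: "0 \<le> p k" for k
  proof (cases "k \<in> K n \<or> k > n")
    case True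
    thus ?thesis using assms(2) by (auto simp: p_def BB_def binomial_eq_0)
  next
    case False
    hence "even (n - k)" by (auto simp: K_def)
    hence "0 \<le> (\<integral>\<omega>. W \<omega> ^ k * (1 - W \<omega>) ^ (n - k) \<partial>M)"
      using W(2) by (intro integral_nonneg_AE) (auto elim!: eventually_mono intro!: mult_nonneg_nonneg simp: zero_le_even_power)
    thus ?thesis by (simp add: p_def)
  qed
  have "(\<Sum>k\<le>n. p k) =
      (\<integral>\<omega>. (\<Sum>k\<le>n. real (n choose k) * (W \<omega> ^ k * (1 - W \<omega>) ^ (n - k))) \<partial>M)"
    unfolding p_def using integrable_bernstein[OF assms(1) W]
    by (subst Bochner_Integration.integral_sum) auto
  also have "\<dots> = (\<integral>\<omega>. (W \<omega> + (1 - W \<omega>)) ^ n \<partial>M)"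
    by (subst binomial_ring) (simp add: mult.assoc)
  also have "\<dots> = 1" by (simp add: prob_space)
  finally have sum: "(\<Sum>k\<le>n. p k) = 1" .
  have "(\<integral>\<^sup>+k. ennreal (p k) \<partial>count_space UNIV) = (\<Sum>k\<le>n. ennreal (p k))"
    by (intro nn_integral_count_space'[of "{..n}"]) (auto simp: p_def not_le binomial_eq_0)
  also have "\<dots> = 1" using sum nonneg by (simp add: sum_ennreal)
  finally show ?thesis
    using pmf_embed_pmf[of p k] nonneg by (simp add: circ_def p_def[abs_def])
qed

end

theory Submission
  imports Defs "HOL-Computational_Algebra.Polynomial"
begin

text \<open>
  Everything is governed by the set of \<^emph>\<open>feasible\<close> scales, the \<open>\<alpha> > 0\<close> with \<open>W / \<alpha> \<in> BB M n\<close>,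
  which is described in two ways.

  On the analytic side, \<open>E[(W/\<alpha>)^k (1 - W/\<alpha>)^(n-k)] = g\<^sub>k(\<alpha>) / \<alpha>^n\<close>, so \<open>\<alpha>\<close> is feasible iff
  \<open>g\<^sub>k(\<alpha>) \<ge> 0\<close> for every \<open>k \<in> K n\<close>. For such \<open>k\<close> the exponent \<open>n - k\<close> is odd, hence
  \<open>\<alpha> \<mapsto> W^k (\<alpha> - W)^(n-k)\<close> increases pointwise, strictly where \<open>W > 0\<close>. If \<open>W\<close> is not almost
  surely zero, \<open>g\<^sub>k\<close> is therefore a strictly increasing polynomial which starts from
  \<open>g\<^sub>k(0) = -E W^n < 0\<close> and has the positive leading coefficient \<open>E W^k\<close>. So it has
  exactly one positive root \<open>\<alpha>\<^sub>k\<close>, and \<open>\<alpha>\<close> is feasible iff \<open>\<alpha> \<ge> max \<alpha>\<^sub>k\<close>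
  (lemmas \<open>ex1_root\<close> and \<open>feasible_iff\<close>).

  On the probabilistic side, for \<open>W \<in> BB M n\<close> and \<open>0 < \<alpha> \<le> 1\<close>, the law of \<open>W \<circ> n\<close> is an
  \<open>\<alpha>\<close>-thinning iff \<open>\<alpha>\<close> is feasible (lemma \<open>circ_in_MM_iff\<close>). Indeed, thinning a binomial law with
  \<open>n\<close> trials and success probability \<open>v\<close> gives the one with success probability \<open>\<alpha> v\<close>. This is a
  polynomial identity in \<open>v\<close>, so it survives integration against any law, even when the resulting
  weights are signed. It says that the weights of \<open>(W/\<alpha>) \<circ> n\<close>, thinned by \<open>\<alpha>\<close>, are those of
  \<open>W \<circ> n\<close>. On weights supported in \<open>{0..n}\<close> thinning by \<open>\<alpha> > 0\<close> is a triangular linear map with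
  nonzero diagonal, so these weights are the only candidate for a preimage; and they form a
  probability law exactly when \<open>\<alpha>\<close> is feasible.

  Hence, for \<open>W \<in> BB M n\<close> not almost surely zero, the scales in the definition of \<open>\<rho>(W \<circ> n)\<close> fill
  the interval from \<open>\<sigma>\<^sub>n(W)\<close> to \<open>1\<close>; and \<open>W / \<sigma>\<^sub>n(W)\<close> has the feasible scales \<open>\<alpha> \<ge> 1\<close>, whence
  \<open>\<rho> = 1\<close> for it.
\<close>

section \<open>Thinning of binomial weights\<close>

text \<open>
  The weight of \<open>W \<circ> n\<close> at \<open>k\<close>, without the requirement \<open>W \<in> BB M n\<close>: it may be negative.
\<close>

definition circ_weight :: "'a measure \<Rightarrow> ('a \<Rightarrow> real) \<Rightarrow> nat \<Rightarrow> nat \<Rightarrow> real" where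
  "circ_weight M W n k = real (n choose k) * (\<integral>\<omega>. W \<omega> ^ k * (1 - W \<omega>) ^ (n - k) \<partial>M)"

lemma pmf_circ_eq_weight:
  assumes "prob_space M" "W \<in> BB M n"
  shows "pmf (circ M W n) k = circ_weight M W n k"
  using pmf_circ[OF assms] by (simp add: circ_weight_def)

text \<open>
  Keeping each of \<open>n\<close> trials with probability \<open>v\<close> and then each survivor with probability \<open>\<alpha>\<close> is
  the same as keeping each with probability \<open>\<alpha> v\<close>; stated for arbitrary real \<open>v\<close> and \<open>\<alpha>\<close>, since
  a random variable in \<open>BB M n\<close> may exceed \<open>1\<close>.
\<close>

lemma binomial_thinning_identity:
  fixes v \<alpha> :: real
  shows "(\<Sum>k\<le>n. real (n choose k) * (v ^ k * (1 - v) ^ (n - k)) *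
             (real (k choose j) * \<alpha> ^ j * (1 - \<alpha>) ^ (k - j)))
         = real (n choose j) * ((\<alpha> * v) ^ j * (1 - \<alpha> * v) ^ (n - j))"
    (is "(\<Sum>k\<le>n. ?f k) = _")
proof (cases "j \<le> n")
  case False
  hence "?f k = 0" if "k \<in> {..n}" for k using that by (simp add: binomial_eq_0)
  hence "(\<Sum>k\<le>n. ?f k) = 0" by (rule sum.neutral[rule_format])
  thus ?thesis using False by (simp add: binomial_eq_0)
next
  case True
  have "(\<Sum>k\<le>n. ?f k) = (\<Sum>k\<in>{j..n}. ?f k)"
    by (rule sum.mono_neutral_right) (auto simp: binomial_eq_0)
  also have "\<dots> = (\<Sum>i\<le>n - j. ?f (j + i))"
    using True by (intro sum.reindex_bij_witness[of _ "\<lambda>i. j + i" "\<lambda>k. k - j"]) auto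
  also have "\<dots> = (\<Sum>i\<le>n - j. real (n choose j) * (\<alpha> * v) ^ j *
      (real ((n - j) choose i) * (v * (1 - \<alpha>)) ^ i * (1 - v) ^ (n - j - i)))"
  proof (rule sum.cong[OF refl])
    fix i assume "i \<in> {..n - j}"
    hence i: "j \<le> j + i" "j + i \<le> n" using True by auto
    have "real (n choose (j + i)) * real ((j + i) choose j) =
        real (n choose j) * real ((n - j) choose i)"
      using choose_mult[OF i] unfolding of_nat_mult[symmetric] by simp
    moreover have "?f (j + i) = (real (n choose (j + i)) * real ((j + i) choose j)) *
        (\<alpha> * v) ^ j * (v * (1 - \<alpha>)) ^ i * (1 - v) ^ (n - j - i)"
      by (simp add: power_add power_mult_distrib diff_diff_eq)
    ultimately show "?f (j + i) = real (n choose j) * (\<alpha> * v) ^ j *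
      (real ((n - j) choose i) * (v * (1 - \<alpha>)) ^ i * (1 - v) ^ (n - j - i))"
      by (simp only: mult_ac)
  qed
  also have "\<dots> = real (n choose j) * (\<alpha> * v) ^ j * (v * (1 - \<alpha>) + (1 - v)) ^ (n - j)"
    by (simp add: binomial_ring sum_distrib_left)
  also have "v * (1 - \<alpha>) + (1 - v) = 1 - \<alpha> * v" by (simp add: algebra_simps)
  finally show ?thesis by (simp add: mult.assoc)
qed

lemma pmf_thin:
  assumes "0 \<le> \<alpha>" "\<alpha> \<le> 1" "set_pmf Z \<subseteq> {..n}"
  shows "pmf (thin \<alpha> Z) j = (\<Sum>k\<le>n. pmf Z k * (real (k choose j) * \<alpha> ^ j * (1 - \<alpha>) ^ (k - j)))"
proof -
  have "pmf (thin \<alpha> Z) j = measure_pmf.expectation Z (\<lambda>k. pmf (binomial_pmf k \<alpha>) j)"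
    using assms by (simp add: thin_eq_binomial pmf_bind)
  also have "\<dots> = (\<Sum>k\<le>n. pmf (binomial_pmf k \<alpha>) j * pmf Z k)"
    using assms by (intro integral_measure_pmf_real) auto
  finally show ?thesis using assms by (simp add: mult.commute)
qed

text \<open>
  With positive probability thinning removes nothing, so it cannot shrink the support from above.
\<close>

lemma set_pmf_subset_thin:
  assumes "0 < \<alpha>" "\<alpha> \<le> 1"
  shows "set_pmf Z \<subseteq> set_pmf (thin \<alpha> Z)"
proof
  fix k assume k: "k \<in> set_pmf Z"
  have "pmf (binomial_pmf k \<alpha>) k \<noteq> 0" using assms by simp
  hence "k \<in> set_pmf (binomial_pmf k \<alpha>)" by (simp add: set_pmf_iff)
  thus "k \<in> set_pmf (thin \<alpha> Z)" using assms k by (auto simp: thin_eq_binomial)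
qed

text \<open>
  Injectivity of thinning on signed weights: the equation at \<open>j\<close> involves only the weights at
  \<open>k \<ge> j\<close>, and the weight at \<open>j\<close> enters with coefficient \<open>\<alpha>^j\<close>, so the weights are determined
  from the top downwards.
\<close>

lemma thinning_weights_inj:
  fixes d :: "nat \<Rightarrow> real"
  assumes "\<alpha> \<noteq> 0"
    and zero: "\<And>j. j \<le> n \<Longrightarrow> (\<Sum>k\<le>n. d k * (real (k choose j) * \<alpha> ^ j * (1 - \<alpha>) ^ (k - j))) = 0"
    and "j \<le> n"
  shows "d j = 0"
  using \<open>j \<le> n\<close>
proof (induction "n - j" arbitrary: j rule: less_induct)
  case less
  have "d k = 0" if "j < k" "k \<le> n" for k
    using that less.hyps[of k] by simp
  hence "d k * (real (k choose j) * \<alpha> ^ j * (1 - \<alpha>) ^ (k - j)) = 0" if "k \<le> n" "k \<noteq> j" for k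
    using that by (cases "k < j") (auto simp: binomial_eq_0)
  hence "(\<Sum>k\<in>{..n} - {j}. d k * (real (k choose j) * \<alpha> ^ j * (1 - \<alpha>) ^ (k - j))) = 0"
    by (intro sum.neutral) blast
  hence "(\<Sum>k\<le>n. d k * (real (k choose j) * \<alpha> ^ j * (1 - \<alpha>) ^ (k - j))) = d j * \<alpha> ^ j"
    using less.prems by (subst sum.remove[of _ j]) auto
  thus ?case using zero[OF less.prems] \<open>\<alpha> \<noteq> 0\<close> by simp
qed

section \<open>Feasible scales of a nonnegative random variable\<close>

locale nonneg_rv = prob_space M for M :: "'a measure" +
  fixes W :: "'a \<Rightarrow> real" and n :: nat
  assumes meas [measurable]: "W \<in> borel_measurable M"
    and nonneg: "AE \<omega> in M. 0 \<le> W \<omega>"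
    and moment: "integrable M (\<lambda>\<omega>. W \<omega> ^ n)"
    and n_pos: "n \<ge> 1"
begin

lemma nonneg_rv_scale: "0 < \<alpha> \<Longrightarrow> nonneg_rv M (\<lambda>\<omega>. W \<omega> / \<alpha>) n"
  using nonneg moment n_pos
  by unfold_locales (auto elim!: eventually_mono simp: power_divide)

lemma integrable_bernstein_W:
  "k \<le> n \<Longrightarrow> integrable M (\<lambda>\<omega>. W \<omega> ^ k * (\<alpha> - W \<omega>) ^ (n - k))"
  using integrable_bernstein[OF prob_space_axioms meas nonneg moment] .

lemma integrable_lower_moment:
  assumes "j \<le> n"
  shows "integrable M (\<lambda>\<omega>. W \<omega> ^ j)"
proof (rule Bochner_Integration.integrable_bound)
  show "integrable M (\<lambda>\<omega>. 1 + W \<omega> ^ n)" using moment by auto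
  show "AE \<omega> in M. norm (W \<omega> ^ j) \<le> norm (1 + W \<omega> ^ n)"
    using nonneg
  proof eventually_elim
    case (elim \<omega>)
    have "W \<omega> ^ j \<le> 1 + W \<omega> ^ n"
    proof (cases "W \<omega> \<le> 1")
      case True
      thus ?thesis using elim power_le_one[of "W \<omega>" j] zero_le_power[OF elim, of n] by linarith
    next
      case False
      hence "W \<omega> ^ j \<le> W \<omega> ^ n" using assms by (intro power_increasing) auto
      thus ?thesis by simp
    qed
    thus ?case using elim by simp
  qed
qed simp

text \<open>Rescaling the Bernstein moments of \<open>W / \<alpha>\<close> by \<open>\<alpha>^n\<close> turns them into polynomials in \<open>\<alpha>\<close>.\<close>

lemma feasible_iff_g_nonneg:
  assumes "0 < \<alpha>"
  shows "(\<lambda>\<omega>. W \<omega> / \<alpha>) \<in> BB M n \<longleftrightarrow> (\<forall>k\<in>K n. 0 \<le> g M W n k \<alpha>)"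
proof -
  interpret V: nonneg_rv M "\<lambda>\<omega>. W \<omega> / \<alpha>" n by (rule nonneg_rv_scale) fact
  have "(\<integral>\<omega>. (W \<omega> / \<alpha>) ^ k * (1 - W \<omega> / \<alpha>) ^ (n - k) \<partial>M) = g M W n k \<alpha> / \<alpha> ^ n"
    if "k \<in> K n" for k
  proof -
    have "(x / \<alpha>) ^ k * (1 - x / \<alpha>) ^ (n - k) = x ^ k * (\<alpha> - x) ^ (n - k) / \<alpha> ^ n" for x
    proof -
      have "1 - x / \<alpha> = (\<alpha> - x) / \<alpha>" using assms by (simp add: field_simps)
      moreover have "\<alpha> ^ n = \<alpha> ^ k * \<alpha> ^ (n - k)"
        using that by (simp add: K_def flip: power_add)
      ultimately show ?thesis by (simp add: power_divide)
    qed
    thus ?thesis by (simp add: g_def)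
  qed
  moreover have "0 \<le> x / \<alpha> ^ n \<longleftrightarrow> 0 \<le> x" for x :: real
    using assms by (simp add: pos_le_divide_eq)
  ultimately show ?thesis using V.nonneg V.moment by (simp add: BB_def)
qed

text \<open>The thinning identity, integrated over the law of \<open>W\<close>.\<close>

lemma thinned_circ_weight:
  "(\<Sum>k\<le>n. circ_weight M W n k * (real (k choose j) * \<alpha> ^ j * (1 - \<alpha>) ^ (k - j)))
     = circ_weight M (\<lambda>\<omega>. \<alpha> * W \<omega>) n j"
proof -
  let ?c = "\<lambda>k. real (k choose j) * \<alpha> ^ j * (1 - \<alpha>) ^ (k - j)"
  have "(\<Sum>k\<le>n. circ_weight M W n k * ?c k) =
     (\<Sum>k\<le>n. \<integral>\<omega>. real (n choose k) * (W \<omega> ^ k * (1 - W \<omega>) ^ (n - k)) * ?c k \<partial>M)"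
    by (simp add: circ_weight_def)
  also have "\<dots> =
     (\<integral>\<omega>. (\<Sum>k\<le>n. real (n choose k) * (W \<omega> ^ k * (1 - W \<omega>) ^ (n - k)) * ?c k) \<partial>M)"
    by (rule Bochner_Integration.integral_sum[symmetric])
       (use integrable_bernstein_W in auto)
  also have "\<dots> = circ_weight M (\<lambda>\<omega>. \<alpha> * W \<omega>) n j"
    by (simp only: binomial_thinning_identity) (simp add: circ_weight_def)
  finally show ?thesis .
qed

text \<open>
  The easy direction exhibits \<open>(W/\<alpha>) \<circ> n\<close> as the law being thinned. Conversely, a law whose
  thinning is \<open>W \<circ> n\<close> has the weights of \<open>(W/\<alpha>) \<circ> n\<close> by injectivity, and the nonnegativity of
  these weights is what membership in \<open>BB M n\<close> demands.
\<close>

lemma circ_in_MM_iff: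
  assumes "W \<in> BB M n" "0 < \<alpha>" "\<alpha> \<le> 1"
  shows "circ M W n \<in> MM \<alpha> \<longleftrightarrow> (\<lambda>\<omega>. W \<omega> / \<alpha>) \<in> BB M n"
proof -
  let ?V = "\<lambda>\<omega>. W \<omega> / \<alpha>"
  let ?c = "\<lambda>k j. real (k choose j) * \<alpha> ^ j * (1 - \<alpha>) ^ (k - j)"
  interpret V: nonneg_rv M ?V n by (rule nonneg_rv_scale) fact
  have weights: "(\<Sum>k\<le>n. circ_weight M ?V n k * ?c k j) = pmf (circ M W n) j" for j
    using V.thinned_circ_weight[where \<alpha> = \<alpha>] assms
    by (simp add: pmf_circ_eq_weight[OF prob_space_axioms])
  have supp: "set_pmf (circ M U n) \<subseteq> {..n}" if "U \<in> BB M n" for U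
    using that by (auto simp: set_pmf_iff pmf_circ_eq_weight[OF prob_space_axioms] circ_weight_def
        not_le[symmetric] intro: binomial_eq_0)
  show ?thesis
  proof
    assume V: "?V \<in> BB M n"
    have "pmf (circ M W n) j = pmf (thin \<alpha> (circ M ?V n)) j" for j
      using assms weights[of j]
      by (simp add: pmf_thin[OF _ _ supp[OF V]] pmf_circ_eq_weight[OF prob_space_axioms V])
    hence "circ M W n = thin \<alpha> (circ M ?V n)" by (rule pmf_eqI)
    thus "circ M W n \<in> MM \<alpha>" by (auto simp: MM_def)
  next
    assume "circ M W n \<in> MM \<alpha>"
    then obtain Z where Z: "circ M W n = thin \<alpha> Z" by (auto simp: MM_def)
    have suppZ: "set_pmf Z \<subseteq> {..n}"
      using set_pmf_subset_thin[OF assms(2,3), of Z] supp[OF assms(1)] Z by simp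
    have "(\<Sum>k\<le>n. (pmf Z k - circ_weight M ?V n k) * ?c k j) = 0" for j
      using weights[of j] pmf_thin[OF _ assms(3) suppZ, of j] assms(2) Z
      by (simp add: left_diff_distrib sum_subtractf)
    hence "pmf Z k - circ_weight M ?V n k = 0" if "k \<le> n" for k
      using thinning_weights_inj[of \<alpha> n "\<lambda>k. pmf Z k - circ_weight M ?V n k" k] that assms(2)
      by simp
    hence "0 \<le> circ_weight M ?V n k" if "k \<le> n" for k
      using that pmf_nonneg[of Z k] by simp
    hence "0 \<le> (\<integral>\<omega>. ?V \<omega> ^ k * (1 - ?V \<omega>) ^ (n - k) \<partial>M)" if "k \<in> K n" for k
      using that by (force simp: circ_weight_def K_def zero_le_mult_iff)
    thus "?V \<in> BB M n" using V.nonneg V.moment by (simp add: BB_def)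
  qed
qed

end

section \<open>The roots and the least feasible scale\<close>

locale nonzero_rv = nonneg_rv +
  assumes not_null: "measure M {\<omega> \<in> space M. W \<omega> = 0} < 1"
begin

lemma nonzero_rv_scale: "0 < \<alpha> \<Longrightarrow> nonzero_rv M (\<lambda>\<omega>. W \<omega> / \<alpha>) n"
  using nonneg_rv_scale[of \<alpha>] not_null
  by (simp add: nonzero_rv_def nonzero_rv_axioms_def)

lemma support_pos: "emeasure M {\<omega> \<in> space M. W \<omega> \<noteq> 0} \<noteq> 0"
proof -
  have "prob {\<omega> \<in> space M. W \<omega> \<noteq> 0} = 1 - prob {\<omega> \<in> space M. W \<omega> = 0}"
    by (rule prob_neg) simp
  thus ?thesis using not_null by (simp add: emeasure_eq_measure)
qed

lemma moment_pos:
  assumes "j \<le> n"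
  shows "0 < (\<integral>\<omega>. W \<omega> ^ j \<partial>M)"
proof -
  have "(\<integral>\<omega>. 0 \<partial>M) < (\<integral>\<omega>. W \<omega> ^ j \<partial>M)"
    by (rule integral_less_AE[OF _ _ support_pos])
       (use integrable_lower_moment[OF assms] nonneg in \<open>auto elim!: eventually_mono\<close>)
  thus ?thesis by simp
qed

lemma g_strict_mono:
  assumes k: "k \<in> K n" and "\<alpha> < \<beta>"
  shows "g M W n k \<alpha> < g M W n k \<beta>"
proof -
  have le: "k \<le> n" and odd: "odd (n - k)" using k by (auto simp: K_def)
  have pow: "(\<alpha> - x) ^ (n - k) < (\<beta> - x) ^ (n - k)" for x
  proof -
    have "(\<alpha> - x) ^ (n - k) \<le> (\<beta> - x) ^ (n - k)"
      using odd \<open>\<alpha> < \<beta>\<close> by (intro power_mono_odd) auto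
    moreover have "(\<alpha> - x) ^ (n - k) \<noteq> (\<beta> - x) ^ (n - k)"
      using odd_real_root_power_cancel[OF odd, of "\<alpha> - x"]
        odd_real_root_power_cancel[OF odd, of "\<beta> - x"] \<open>\<alpha> < \<beta>\<close> by auto
    ultimately show ?thesis by simp
  qed
  show ?thesis
    unfolding g_def
  proof (rule integral_less_AE[OF _ _ support_pos])
    show "AE \<omega> in M. \<omega> \<in> {\<omega> \<in> space M. W \<omega> \<noteq> 0} \<longrightarrow>
        W \<omega> ^ k * (\<alpha> - W \<omega>) ^ (n - k) \<noteq> W \<omega> ^ k * (\<beta> - W \<omega>) ^ (n - k)"
      using pow by (intro AE_I2) (auto simp: less_imp_neq)
    show "AE \<omega> in M. W \<omega> ^ k * (\<alpha> - W \<omega>) ^ (n - k) \<le> W \<omega> ^ k * (\<beta> - W \<omega>) ^ (n - k)"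
      using nonneg by eventually_elim (use pow in \<open>auto intro!: mult_left_mono intro: less_imp_le\<close>)
  qed (use integrable_bernstein_W[OF le] in auto)
qed

lemma g_zero_neg:
  assumes "k \<in> K n"
  shows "g M W n k 0 < 0"
proof -
  have le: "k \<le> n" and odd: "odd (n - k)" using assms by (auto simp: K_def)
  have "x ^ k * (0 - x) ^ (n - k) = - (x ^ n)" for x :: real
    using le odd by (simp flip: power_add)
  thus ?thesis using moment_pos[of n] by (simp add: g_def)
qed

lemma g_is_poly:
  assumes "k \<le> n"
  obtains p where "\<And>\<alpha>. g M W n k \<alpha> = poly p \<alpha>" "0 < lead_coeff p"
proof -
  define m where "m = n - k"
  define c where "c i = real (m choose i) * (-1) ^ (m - i) * (\<integral>\<omega>. W \<omega> ^ (n - i) \<partial>M)" for i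
  define p where "p = (\<Sum>i\<le>m. monom (c i) i)"
  have int: "integrable M (\<lambda>\<omega>. W \<omega> ^ (n - i))" for i
    by (intro integrable_lower_moment) simp
  have "g M W n k \<alpha> = poly p \<alpha>" for \<alpha>
  proof -
    have "x ^ k * (\<alpha> - x) ^ m =
        (\<Sum>i\<le>m. real (m choose i) * (-1) ^ (m - i) * \<alpha> ^ i * x ^ (n - i))" for x
    proof -
      have "(\<alpha> - x) ^ m = (\<Sum>i\<le>m. real (m choose i) * \<alpha> ^ i * (- x) ^ (m - i))"
        using binomial_ring[of \<alpha> "- x" m] by simp
      also have "x ^ k * \<dots> =
          (\<Sum>i\<le>m. real (m choose i) * (-1) ^ (m - i) * \<alpha> ^ i * x ^ (n - i))"
        unfolding sum_distrib_left
      proof (intro sum.cong refl)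
        fix i assume "i \<in> {..m}"
        hence "n - i = k + (m - i)" using assms by (simp add: m_def)
        thus "x ^ k * (real (m choose i) * \<alpha> ^ i * (- x) ^ (m - i)) =
            real (m choose i) * (-1) ^ (m - i) * \<alpha> ^ i * x ^ (n - i)"
          by (subst power_minus) (simp only: power_add ac_simps)
      qed
      finally show ?thesis .
    qed
    hence "g M W n k \<alpha> =
        (\<integral>\<omega>. (\<Sum>i\<le>m. real (m choose i) * (-1) ^ (m - i) * \<alpha> ^ i * W \<omega> ^ (n - i)) \<partial>M)"
      by (simp add: g_def m_def)
    also have "\<dots> = (\<Sum>i\<le>m. c i * \<alpha> ^ i)"
      by (subst Bochner_Integration.integral_sum)
         (use int in \<open>auto simp: c_def intro!: sum.cong\<close>)
    finally show ?thesis by (simp add: p_def poly_sum poly_monom)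
  qed
  moreover have "0 < lead_coeff p"
  proof -
    have coeff: "coeff p i = (if i \<le> m then c i else 0)" for i
      by (simp add: p_def coeff_sum)
    have "0 < c m" using moment_pos[OF assms] assms by (simp add: c_def m_def)
    moreover have "degree p = m"
      using \<open>0 < c m\<close> by (intro antisym degree_le le_degree) (auto simp: coeff)
    ultimately show ?thesis by (simp add: coeff)
  qed
  ultimately show thesis by (rule that)
qed

lemma ex1_root:
  assumes "k \<in> K n"
  shows "\<exists>!\<alpha>. 0 < \<alpha> \<and> g M W n k \<alpha> = 0"
proof (rule ex_ex1I)
  have "k \<le> n" using assms by (simp add: K_def)
  from g_is_poly[OF this] obtain p
    where p: "\<And>\<alpha>. g M W n k \<alpha> = poly p \<alpha>" "0 < lead_coeff p" by metis
  obtain b where b: "\<And>x. b \<le> x \<Longrightarrow> lead_coeff p \<le> poly p x"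
    using poly_pinfty_gt_lc[OF p(2)] by blast
  have "poly p 0 < 0" using g_zero_neg[OF assms] p(1) by simp
  moreover have "0 < poly p (max 1 b)" using b[of "max 1 b"] p(2) by simp
  ultimately show "\<exists>\<alpha>. 0 < \<alpha> \<and> g M W n k \<alpha> = 0"
    using poly_IVT_pos[of 0 "max 1 b" p] p(1) by (auto simp: less_max_iff_disj)
next
  fix \<alpha> \<beta> assume "0 < \<alpha> \<and> g M W n k \<alpha> = 0" "0 < \<beta> \<and> g M W n k \<beta> = 0"
  thus "\<alpha> = \<beta>"
    using g_strict_mono[OF assms, of \<alpha> \<beta>] g_strict_mono[OF assms, of \<beta> \<alpha>]
    by (cases \<alpha> \<beta> rule: linorder_cases) auto
qed

definition pos_root :: "nat \<Rightarrow> real" where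
  "pos_root k = (THE \<alpha>. 0 < \<alpha> \<and> g M W n k \<alpha> = 0)"

lemma pos_root_pos: "k \<in> K n \<Longrightarrow> 0 < pos_root k"
  and g_pos_root: "k \<in> K n \<Longrightarrow> g M W n k (pos_root k) = 0"
  using theI'[OF ex1_root, of k] by (auto simp: pos_root_def)

lemma g_nonneg_iff:
  assumes "k \<in> K n"
  shows "0 \<le> g M W n k \<alpha> \<longleftrightarrow> pos_root k \<le> \<alpha>"
  using g_strict_mono[OF assms, of \<alpha> "pos_root k"] g_strict_mono[OF assms, of "pos_root k" \<alpha>]
    g_pos_root[OF assms]
  by (cases \<alpha> "pos_root k" rule: linorder_cases) auto

lemma finite_K: "finite (K n)"
  by (rule finite_subset[of _ "{..n}"]) (auto simp: K_def)

lemma K_nonempty: "K n \<noteq> {}"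
proof -
  have "n - 1 \<in> K n" using n_pos by (simp add: K_def)
  thus ?thesis by blast
qed

lemma Max_pos_root_pos: "0 < Max (pos_root ` K n)"
  using finite_K K_nonempty pos_root_pos by (subst Max_gr_iff) auto

lemma feasible_iff:
  "0 < \<alpha> \<and> (\<lambda>\<omega>. W \<omega> / \<alpha>) \<in> BB M n \<longleftrightarrow> Max (pos_root ` K n) \<le> \<alpha>"
proof -
  have "Max (pos_root ` K n) \<le> \<alpha> \<longleftrightarrow> (\<forall>k\<in>K n. 0 \<le> g M W n k \<alpha>)"
    using finite_K K_nonempty by (simp add: g_nonneg_iff)
  thus ?thesis using feasible_iff_g_nonneg[of \<alpha>] Max_pos_root_pos by fastforce
qed

lemma sigma_n_eq_Max: "sigma_n M n W = Max (pos_root ` K n)"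
  unfolding sigma_n_def feasible_iff by (simp flip: atLeast_def)

lemma sigma_n_pos: "0 < sigma_n M n W"
  using Max_pos_root_pos by (simp add: sigma_n_eq_Max)

lemma feasible_iff_sigma_n:
  "0 < \<alpha> \<Longrightarrow> (\<lambda>\<omega>. W \<omega> / \<alpha>) \<in> BB M n \<longleftrightarrow> sigma_n M n W \<le> \<alpha>"
  using feasible_iff[of \<alpha>] by (simp add: sigma_n_eq_Max)

lemma sigma_n_normalized: "sigma_n M n (\<lambda>\<omega>. W \<omega> / sigma_n M n W) = 1"
proof -
  let ?s = "sigma_n M n W"
  have "(0 < \<alpha> \<and> (\<lambda>\<omega>. W \<omega> / ?s / \<alpha>) \<in> BB M n) \<longleftrightarrow> 1 \<le> \<alpha>" for \<alpha>
    using feasible_iff_sigma_n[of "?s * \<alpha>"] sigma_n_pos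
    by (cases "0 < \<alpha>") (auto simp: divide_divide_eq_left mult_le_cancel_left1)
  thus ?thesis unfolding sigma_n_def[of M n "\<lambda>\<omega>. W \<omega> / ?s"] by (simp flip: atLeast_def)
qed

text \<open>
  Thinning by \<open>0\<close> leaves the point mass at \<open>0\<close>, whereas \<open>W \<circ> n\<close> charges \<open>n\<close> with mass \<open>E W^n > 0\<close>.
\<close>

lemma circ_notin_MM_0:
  assumes "W \<in> BB M n"
  shows "circ M W n \<notin> MM 0"
proof
  assume "circ M W n \<in> MM 0"
  then obtain Z where "circ M W n = thin 0 Z" by (auto simp: MM_def)
  also have "\<dots> = return_pmf 0"
  proof -
    have "binomial_pmf x 0 = return_pmf 0" for x
      by (subst set_pmf_subset_singleton[symmetric]) simp
    thus ?thesis by (simp add: thin_eq_binomial)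
  qed
  finally have "pmf (circ M W n) n = 0" using n_pos by simp
  thus False
    using moment_pos[of n] by (simp add: pmf_circ_eq_weight[OF prob_space_axioms assms] circ_weight_def)
qed

lemma rho_circ:
  assumes "W \<in> BB M n"
  shows "rho (circ M W n) = sigma_n M n W"
proof -
  have "sigma_n M n W \<le> 1" using feasible_iff_sigma_n[of 1] assms by simp
  moreover have "\<alpha> \<in> {0..1} \<and> circ M W n \<in> MM \<alpha> \<longleftrightarrow> \<alpha> \<in> {sigma_n M n W..1}" for \<alpha>
    using circ_in_MM_iff[OF assms, of \<alpha>] feasible_iff_sigma_n[of \<alpha>] sigma_n_pos
      circ_notin_MM_0[OF assms]
    by (cases \<alpha> "0 :: real" rule: linorder_cases) auto
  hence "{\<alpha> \<in> {0..1}. circ M W n \<in> MM \<alpha>} = {sigma_n M n W..1}" by blast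
  ultimately show ?thesis by (simp add: rho_def)
qed

end

section \<open>The degenerate case\<close>

context nonneg_rv
begin

text \<open>
  If \<open>W = 0\<close> almost surely, every Bernstein moment of \<open>W / \<alpha>\<close> vanishes except for the one of
  index \<open>0\<close>, which is \<open>1\<close>; so every positive scale is feasible.
\<close>

lemma null_feasible:
  assumes "AE \<omega> in M. W \<omega> = 0" "0 < \<alpha>"
  shows "(\<lambda>\<omega>. W \<omega> / \<alpha>) \<in> BB M n"
proof -
  have "0 \<le> g M W n k \<alpha>" if "k \<in> K n" for k
    unfolding g_def
  proof (rule integral_nonneg_AE)
    show "AE \<omega> in M. 0 \<le> W \<omega> ^ k * (\<alpha> - W \<omega>) ^ (n - k)"
      using assms(1) by eventually_elim (use assms(2) in auto)
  qed
  thus ?thesis using feasible_iff_g_nonneg[OF assms(2)] by blast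
qed

lemma null_sigma_n:
  assumes "AE \<omega> in M. W \<omega> = 0"
  shows "sigma_n M n W = 0"
proof -
  have "{\<alpha>. 0 < \<alpha> \<and> (\<lambda>\<omega>. W \<omega> / \<alpha>) \<in> BB M n} = {0<..}"
    using null_feasible[OF assms] by auto
  thus ?thesis by (simp add: sigma_n_def)
qed

lemma null_rho_circ:
  assumes "AE \<omega> in M. W \<omega> = 0"
  shows "rho (circ M W n) = 0"
proof -
  let ?S = "{\<alpha> \<in> {0..1}. circ M W n \<in> MM \<alpha>}"
  have "W \<in> BB M n" using null_feasible[OF assms, of 1] by simp
  hence sub: "{0<..1} \<subseteq> ?S"
    using circ_in_MM_iff null_feasible[OF assms] by auto
  have "Inf ?S \<le> Inf {0<..1}"
    by (rule cInf_superset_mono[OF _ _ sub]) (auto intro!: bdd_belowI[of _ 0])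
  moreover have "0 \<le> Inf ?S"
  proof (rule cInf_greatest)
    have "1 \<in> ?S" by (rule subsetD[OF sub]) simp
    thus "?S \<noteq> {}" by blast
  qed simp
  ultimately show ?thesis by (simp add: rho_def)
qed

end

theorem theorem19:
  fixes M :: "'a measure" and W :: "'a \<Rightarrow> real" and n :: nat
  assumes "prob_space M"
    and "n \<ge> 1"
    and "W \<in> borel_measurable M"
    and "AE \<omega> in M. 0 \<le> W \<omega>"
  shows "(measure M {\<omega> \<in> space M. W \<omega> = 0} = 1 \<longrightarrow> sigma_n M n W = 0) \<and>
    (measure M {\<omega> \<in> space M. W \<omega> = 0} < 1 \<and> integrable M (\<lambda>\<omega>. W \<omega> ^ n) \<longrightarrow>
       (\<forall>k\<in>K n. \<exists>!\<alpha>. 0 < \<alpha> \<and> g M W n k \<alpha> = 0) \<and>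
       sigma_n M n W = Max ((\<lambda>k. THE \<alpha>. 0 < \<alpha> \<and> g M W n k \<alpha> = 0) ` K n) \<and>
       (\<lambda>\<omega>. W \<omega> / sigma_n M n W) \<in> BB M n \<and>
       rho (circ M (\<lambda>\<omega>. W \<omega> / sigma_n M n W) n) = 1) \<and>
    (W \<in> BB M n \<longrightarrow> rho (circ M W n) = sigma_n M n W)"
proof -
  interpret prob_space M by fact
  note [measurable] = \<open>W \<in> borel_measurable M\<close>
  let ?null = "{\<omega> \<in> space M. W \<omega> = 0}"
  have AE_null: "AE \<omega> in M. W \<omega> = 0" if "prob ?null = 1"
    using that by (subst prob_Collect_eq_1[symmetric]) auto
  have rv: "nonneg_rv M W n" if "integrable M (\<lambda>\<omega>. W \<omega> ^ n)"
    using assms that by (simp add: nonneg_rv_def nonneg_rv_axioms_def)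
  have rv_null: "nonneg_rv M W n" if "prob ?null = 1"
  proof (rule rv)
    have "AE \<omega> in M. W \<omega> ^ n = 0"
      using AE_null[OF that] by eventually_elim (use \<open>n \<ge> 1\<close> in auto)
    thus "integrable M (\<lambda>\<omega>. W \<omega> ^ n)"
      by (subst integrable_cong_AE[where g = "\<lambda>_. 0"]) auto
  qed
  have rv_nonzero: "nonzero_rv M W n" if "prob ?null < 1" "integrable M (\<lambda>\<omega>. W \<omega> ^ n)"
    using rv[OF that(2)] that(1) by (simp add: nonzero_rv_def nonzero_rv_axioms_def)
  show ?thesis
  proof (intro conjI[of "_ \<longrightarrow> _"] impI)
    assume "prob ?null = 1"
    thus "sigma_n M n W = 0"
      using nonneg_rv.null_sigma_n[OF rv_null] AE_null by blast
  next
    assume asm: "prob ?null < 1 \<and> integrable M (\<lambda>\<omega>. W \<omega> ^ n)"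
    interpret nonzero_rv M W n using rv_nonzero asm by blast
    let ?s = "sigma_n M n W"
    interpret V: nonzero_rv M "\<lambda>\<omega>. W \<omega> / ?s" n
      by (rule nonzero_rv_scale[OF sigma_n_pos])
    have V: "(\<lambda>\<omega>. W \<omega> / ?s) \<in> BB M n"
      using feasible_iff_sigma_n[OF sigma_n_pos] by simp
    show "(\<forall>k\<in>K n. \<exists>!\<alpha>. 0 < \<alpha> \<and> g M W n k \<alpha> = 0) \<and>
       ?s = Max ((\<lambda>k. THE \<alpha>. 0 < \<alpha> \<and> g M W n k \<alpha> = 0) ` K n) \<and>
       (\<lambda>\<omega>. W \<omega> / ?s) \<in> BB M n \<and>
       rho (circ M (\<lambda>\<omega>. W \<omega> / ?s) n) = 1"
      using ex1_root sigma_n_eq_Max V V.rho_circ[OF V] sigma_n_normalized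
      by (simp add: pos_root_def[abs_def])
  next
    assume W: "W \<in> BB M n"
    show "rho (circ M W n) = sigma_n M n W"
    proof (cases "prob ?null = 1")
      case True
      interpret nonneg_rv M W n by (rule rv_null) fact
      show ?thesis using null_rho_circ null_sigma_n AE_null[OF True] by simp
    next
      case False
      hence "prob ?null < 1" using prob_le_1[of ?null] by linarith
      moreover have "integrable M (\<lambda>\<omega>. W \<omega> ^ n)" using W by (simp add: BB_def)
      ultimately interpret nonzero_rv M W n by (rule rv_nonzero)
      show ?thesis by (rule rho_circ) fact
    qed
  qed
qed

end
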